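(* Let $A\in\mathbb{R}^{m\times n}$, $m\ge n$, have full column rank, let $\mathbf{b}\in\mathbb{R}^m$, let $W\in\mathbb{R}^{m\times m}$ be symmetric positive definite, and let $L\in\mathbb{R}^{n\times k}$, $k\le n$. When the infinity norm is chosen on the solution space $\mathbb{R}^k$, the condition number $\mathcal{K}_\infty$ of the weighted least squares solution map $g(A,\mathbf{b})=L^{\mathrm T}(A^{\mathrm T}WA)^{-1}A^{\mathrm T}W\mathbf{b}$ at $(A,\mathbf{b})$ is $$\mathcal{K}_{\infty}=\Big\|\sum_{j=1}^n\big|L^{\mathrm T}(A^{\mathrm T}WA)^{-1}(\mathbf{e}_j\mathbf{d}^{\mathrm T}-x_jA^{\mathrm T}W)\big|\,|A(:,j)|+|L^{\mathrm T}A_{W,I_n}^{\dagger}|\,|\mathbf{b}|\Big\|_{\infty}.$$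
   Context: Notation: $A_{W,I_n}^{\dagger}=(A^{\mathrm T}WA)^{-1}A^{\mathrm T}W$; $\mathbf{x}=A_{W,I_n}^{\dagger}\mathbf{b}$ with components $x_j$; $\mathbf{d}=W(\mathbf{b}-A\mathbf{x})$; $\mathbf{e}_j$ is the $j$th unit vector of $\mathbb{R}^n$; $A(:,j)$ is the $j$th column of $A$; $|\cdot|$ is the entrywise absolute value. Condition number: $W$ and $L$ are fixed and $g$ is a function of the data $(A,\mathbf{b})$. A perturbation $(\Delta A,\Delta\mathbf{b})\in\mathbb{R}^{m\times n}\times\mathbb{R}^m$ is admissible if each of its entries vanishes wherever the corresponding entry of $(A,\mathbf{b})$ vanishes. For admissible perturbations, $\|(\Delta A,\Delta\mathbf{b})\|_c=\min\{\omega:\ |\Delta A|\le\omega|A|,\ |\Delta\mathbf{b}|\le\omega|\mathbf{b}|\}$ (entrywise). Then $\mathcal{K}_\infty=\max\{\|g'(A,\mathbf{b})\cdot(\Delta A,\Delta\mathbf{b})\|_\infty:\ (\Delta A,\Delta\mathbf{b})\text{ admissible},\ \|(\Delta A,\Delta\mathbf{b})\|_c=1\}$, where $g'$ is the Fréchet derivative. *)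

theory Defs
  imports "HOL-Analysis.Analysis"
begin

(* The order and the absolute value on real vectors and on real matrices (vectors of rows)
   are the componentwise library instances, so \<bar>M\<bar> and M \<le> N are entrywise. *)

definition symmetric_positive_definite :: "real^'m^'m \<Rightarrow> bool" where
  "symmetric_positive_definite W \<longleftrightarrow>
     transpose W = W \<and> (\<forall>v. v \<noteq> 0 \<longrightarrow> 0 < v \<bullet> (W *v v))"

definition outer_product :: "real^'n \<Rightarrow> real^'m \<Rightarrow> real^'m^'n" where
  "outer_product u v = (\<chi> i j. u $ i * v $ j)"

(* The weighted pseudoinverse of A with weight W on the data space and the identity weight on
   the solution space; it is meaningful when the columns of A are linearly independent. *)
definition weighted_pinv :: "real^'m^'m \<Rightarrow> real^'n^'m \<Rightarrow> real^'m^'n" where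
  "weighted_pinv W A = matrix_inv (transpose A ** W ** A) ** transpose A ** W"

definition wls_map :: "real^'m^'m \<Rightarrow> real^'k^'n \<Rightarrow> (real^'n^'m) \<times> (real^'m) \<Rightarrow> real^'k" where
  "wls_map W L = (\<lambda>(A, b). transpose L *v (weighted_pinv W A *v b))"

definition admissible ::
    "(real^'n^'m) \<times> (real^'m) \<Rightarrow> (real^'n^'m) \<times> (real^'m) \<Rightarrow> bool" where
  "admissible = (\<lambda>(A, b) (\<Delta>A, \<Delta>b).
     (\<forall>i j. A $ i $ j = 0 \<longrightarrow> \<Delta>A $ i $ j = 0) \<and> (\<forall>i. b $ i = 0 \<longrightarrow> \<Delta>b $ i = 0))"

(* LEAST on the reals is the minimum; it exists for admissible perturbations of nonzero data. *)
definition componentwise_norm ::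
    "(real^'n^'m) \<times> (real^'m) \<Rightarrow> (real^'n^'m) \<times> (real^'m) \<Rightarrow> real" where
  "componentwise_norm = (\<lambda>(A, b) (\<Delta>A, \<Delta>b).
     LEAST \<omega>. \<bar>\<Delta>A\<bar> \<le> \<omega> *\<^sub>R \<bar>A\<bar> \<and> \<bar>\<Delta>b\<bar> \<le> \<omega> *\<^sub>R \<bar>b\<bar>)"

(* GREATEST is the attained maximum, not merely a supremum. *)
definition cond_inf ::
    "((real^'n^'m) \<times> (real^'m) \<Rightarrow> real^'k) \<Rightarrow> (real^'n^'m) \<times> (real^'m) \<Rightarrow> real" where
  "cond_inf g p =
     (GREATEST r. \<exists>\<Delta>. admissible p \<Delta> \<and> componentwise_norm p \<Delta> = 1 \<and>
                      r = infnorm (frechet_derivative g (at p) \<Delta>))"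

end

theory Submission
  imports Defs
begin

text \<open>
  The condition number is the largest value of \<open>\<parallel>T (\<Delta>A, \<Delta>b)\<parallel>\<close> in the infinity norm, where
  \<open>T\<close> is the derivative of the solution map at \<open>(A, b)\<close> and every entry of \<open>\<Delta>A\<close>, \<open>\<Delta>b\<close> is
  bounded in modulus by the entry of \<open>A\<close>, \<open>b\<close> in the same place. Two independent facts
  determine it. Below, \<open>x\<close> is the solution at \<open>(A, b)\<close>; the fixed matrix \<open>L\<^sup>T\<close> only multiplies the
  derivative of the solution from the left.

  The derivative comes from the normal equations. The solution \<open>y\<close> of \<open>M y = c\<close>, with
  \<open>M = A\<^sup>TWA\<close> and \<open>c = A\<^sup>TWb\<close>, is differentiable in the data because Cramer's rule writes it as a
  quotient of determinants; the product rule applied to \<open>M y = c\<close> then forces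
  \<open>y' = M\<^sup>-\<^sup>1 (c' - M' y)\<close> (\<open>has_derivative_matrix_inv_solution\<close>). With
  \<open>d = W (b - A x)\<close> this is \<open>M\<^sup>-\<^sup>1 (\<Delta>A\<^sup>T d - A\<^sup>TW \<Delta>A x + A\<^sup>TW \<Delta>b)\<close>
  (\<open>wls_map_has_derivative\<close>). Since
  \<open>\<Delta>A\<^sup>T d = \<Sum>\<^sub>j e\<^sub>j d\<^sup>T \<Delta>A(:,j)\<close> and \<open>\<Delta>A x = \<Sum>\<^sub>j x\<^sub>j \<Delta>A(:,j)\<close>, it becomes a sum of
  coefficient matrices acting on the columns of \<open>\<Delta>A\<close> and on \<open>\<Delta>b\<close>
  (\<open>wls_derivative_by_columns\<close>).

  The maximum is then elementary (\<open>cond_inf_of_linear_derivative\<close>). In each component \<open>T\<close> is a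
  linear form in independent entries, so the triangle inequality bounds it by the form with all
  coefficients and all data replaced by their moduli, and giving every entry of the
  perturbation the sign of its coefficient attains the bound for any one chosen component. A
  component where the bound is largest is the only one that counts for the infinity norm.
\<close>

section \<open>Differentiating the solution of a linear system\<close>

lemma matrix_inv_inverse:
  fixes M :: "'a::semiring_1^'n^'n"
  assumes "invertible M"
  shows "M ** matrix_inv M = mat 1 \<and> matrix_inv M ** M = mat 1"
  using assms unfolding matrix_inv_def invertible_def by (rule someI_ex)

lemma bounded_bilinear_matrix_vector_mult:
  "bounded_bilinear ((*v) :: real^'n^'m \<Rightarrow> real^'n \<Rightarrow> real^'m)"
  unfolding bilinear_conv_bounded_bilinear[symmetric] bilinear_def
  by (auto intro!: linearI simp: algebra_simps scaleR_matrix_vector_assoc)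

lemma bounded_bilinear_matrix_matrix_mult:
  "bounded_bilinear ((**) :: real^'n^'m \<Rightarrow> real^'k^'n \<Rightarrow> real^'k^'m)"
  unfolding bilinear_conv_bounded_bilinear[symmetric] bilinear_def
  by (auto intro!: linearI
      simp: vec_eq_iff matrix_matrix_mult_def sum_distrib_left sum.distrib algebra_simps)

lemma bounded_linear_transpose: "bounded_linear (transpose :: real^'n^'m \<Rightarrow> real^'m^'n)"
  unfolding linear_conv_bounded_linear[symmetric]
  by (auto intro!: linearI simp: transpose_def vec_eq_iff)

lemma differentiable_prod:
  fixes f :: "'i \<Rightarrow> 'a::real_normed_vector \<Rightarrow> 'b::real_normed_field"
  assumes "\<And>i. i \<in> I \<Longrightarrow> f i differentiable (at x within S)"
  shows "(\<lambda>x. \<Prod>i\<in>I. f i x) differentiable (at x within S)"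
proof -
  obtain f' where "\<And>i. i \<in> I \<Longrightarrow> (f i has_derivative f' i) (at x within S)"
    using assms unfolding differentiable_def by metis
  then show ?thesis
    by (rule differentiableI[OF has_derivative_prod])
qed

lemma differentiable_vec_nth:
  assumes "f differentiable F"
  shows "(\<lambda>x. f x $ i) differentiable F"
  using assms unfolding differentiable_def
  by (blast intro: bounded_linear.has_derivative[OF bounded_linear_vec_nth])

text \<open>
  The hypothesis is entrywise because Cramer's rule applies the lemma to matrices in which one
  column is replaced by the right-hand side.
\<close>
lemma differentiable_det:
  fixes M :: "'a::real_normed_vector \<Rightarrow> real^'n^'n"
  assumes "\<And>i j. (\<lambda>q. M q $ i $ j) differentiable (at p)"
  shows "(\<lambda>q. det (M q)) differentiable (at p)"
proof -
  have "(\<lambda>q. of_int (sign \<pi>) * (\<Prod>i\<in>UNIV. M q $ i $ \<pi> i)) differentiable (at p)" for \<pi> :: "'n \<Rightarrow> 'n"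
    by (rule differentiable_mult[OF differentiable_const differentiable_prod[OF assms]])
  then show ?thesis
    unfolding det_def by (intro differentiable_sum) auto
qed

text \<open>
  Cramer's rule expresses the solution by determinants of matrices whose entries are entries of
  \<open>M\<close> and \<open>c\<close>. This gives differentiability without a formula for the derivative, and the
  continuity of the determinant keeps the system solvable near \<open>p\<close>.
\<close>
lemma differentiable_matrix_inv_solution:
  fixes M :: "'a::real_normed_vector \<Rightarrow> real^'n^'n" and c :: "'a \<Rightarrow> real^'n"
  assumes M: "M differentiable (at p)" and c: "c differentiable (at p)" and inv: "invertible (M p)"
  shows "(\<lambda>q. matrix_inv (M q) *v c q) differentiable (at p)"
    and "\<forall>\<^sub>F q in at p. invertible (M q)"
proof -
  have det: "(\<lambda>q. det (M q)) differentiable (at p)"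
    by (intro differentiable_det differentiable_vec_nth M)
  have nz: "det (M p) \<noteq> 0"
    using inv by (simp add: invertible_det_nz)
  have ev: "\<forall>\<^sub>F q in at p. det (M q) \<noteq> 0"
    using tendsto_imp_eventually_ne[OF differentiable_imp_continuous_within[OF det, unfolded continuous_within] nz] .
  then show "\<forall>\<^sub>F q in at p. invertible (M q)"
    by (simp add: invertible_det_nz)
  define y where "y = (\<lambda>q. \<chi> k. det (\<chi> i j. if j = k then c q $ i else M q $ i $ j) / det (M q))"
  have "(\<lambda>q. y q $ k) differentiable (at p)" for k
    unfolding y_def vec_lambda_beta
  proof (rule differentiable_divide[OF differentiable_det det nz])
    show "(\<lambda>q. (\<chi> i j. if j = k then c q $ i else M q $ i $ j) $ i $ j) differentiable (at p)" for i j
      using differentiable_vec_nth[OF c, of i] differentiable_vec_nth[OF differentiable_vec_nth[OF M]]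
      by (cases "j = k") simp_all
  qed
  then have "y differentiable (at p)"
    by (subst differentiable_componentwise_within) (auto simp: Basis_vec_def inner_axis)
  moreover have eq: "y q = matrix_inv (M q) *v c q" if "det (M q) \<noteq> 0" for q
    using that matrix_inv_inverse[of "M q"] cramer[OF that, of "matrix_inv (M q) *v c q" "c q"]
    by (simp add: y_def matrix_vector_mul_assoc invertible_det_nz)
  ultimately obtain D where "(y has_derivative D) (at p)"
    unfolding differentiable_def by blast
  then have "((\<lambda>q. matrix_inv (M q) *v c q) has_derivative D) (at p)"
    by (rule has_derivative_transform_eventually) (use eventually_mono[OF ev eq] eq[OF nz] in auto)
  then show "(\<lambda>q. matrix_inv (M q) *v c q) differentiable (at p)"
    by (rule differentiableI)
qed

text \<open>
  Differentiating \<open>M q *v y q = c q\<close>, where \<open>y\<close> is already known to be differentiable, gives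
  \<open>M *v y' + M' *v y = c'\<close>; solving for \<open>y'\<close> leaves no derivative of the inverse matrix itself.
\<close>
lemma has_derivative_matrix_inv_solution:
  fixes M :: "'a::real_normed_vector \<Rightarrow> real^'n^'n" and c :: "'a \<Rightarrow> real^'n"
  assumes M: "(M has_derivative M') (at p)" and c: "(c has_derivative c') (at p)"
    and inv: "invertible (M p)"
  shows "((\<lambda>q. matrix_inv (M q) *v c q) has_derivative
          (\<lambda>h. matrix_inv (M p) *v (c' h - M' h *v (matrix_inv (M p) *v c p)))) (at p)"
proof -
  let ?y = "\<lambda>q. matrix_inv (M q) *v c q"
  have dM: "M differentiable (at p)" and dc: "c differentiable (at p)"
    using M c by (auto simp: differentiable_def)
  note sol = differentiable_matrix_inv_solution[OF dM dc inv]
  obtain y' where y': "(?y has_derivative y') (at p)"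
    using sol(1) by (auto simp: differentiable_def)
  have eq: "M q *v ?y q = c q" if "invertible (M q)" for q
    using matrix_inv_inverse[OF that] by (simp add: matrix_vector_mul_assoc)
  have "((\<lambda>q. M q *v ?y q) has_derivative (\<lambda>h. M p *v y' h + M' h *v ?y p)) (at p)"
    by (rule bounded_bilinear.FDERIV[OF bounded_bilinear_matrix_vector_mult M y'])
  \<comment> \<open>The product agrees with \<open>c\<close> only near \<open>p\<close>, which is enough to compare the derivatives.\<close>
  then have "(c has_derivative (\<lambda>h. M p *v y' h + M' h *v ?y p)) (at p)"
    by (rule has_derivative_transform_eventually)
      (use eventually_mono[OF sol(2) eq] eq[OF inv] in auto)
  from has_derivative_unique[OF c this]
  have "c' h - M' h *v ?y p = M p *v y' h" for h
    by simp
  then have "matrix_inv (M p) *v (c' h - M' h *v ?y p) = y' h" for h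
    using matrix_inv_inverse[OF inv] by (simp add: matrix_vector_mul_assoc)
  with y' show ?thesis by simp
qed

section \<open>The derivative of the weighted least squares solution\<close>

text \<open>
  If \<open>A\<^sup>TWA x = 0\<close> then \<open>(Ax)\<^sup>T W (Ax) = 0\<close>, so \<open>Ax = 0\<close> by definiteness and \<open>x = 0\<close> by full
  column rank.
\<close>
lemma invertible_gram:
  fixes A :: "real^'n^'m" and W :: "real^'m^'m"
  assumes "rank A = CARD('n)" and pos: "\<And>v. v \<noteq> 0 \<Longrightarrow> 0 < v \<bullet> (W *v v)"
  shows "invertible (transpose A ** W ** A)"
proof -
  have inj: "A *v x = 0 \<Longrightarrow> x = 0" for x
    using assms(1) by (metis full_rank_injective inj_eq matrix_vector_mult_0_right)
  have "x = 0" if 0: "(transpose A ** W ** A) *v x = 0" for x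
  proof (rule ccontr)
    assume "x \<noteq> 0"
    then have "0 < (A *v x) \<bullet> (W *v (A *v x))"
      using inj pos by blast
    also have "\<dots> = ((W *v (A *v x)) v* A) \<bullet> x"
      by (subst dot_lmul_matrix) (rule inner_commute)
    also have "\<dots> = ((transpose A ** W ** A) *v x) \<bullet> x"
      by (simp only: transpose_matrix_vector[symmetric] matrix_vector_mul_assoc matrix_mul_assoc)
    finally show False using 0 by simp
  qed
  then show ?thesis
    by (meson invertible_left_inverse matrix_left_invertible_ker)
qed

text \<open>
  The two terms containing \<open>\<Delta>A\<^sup>T\<close>, one from the right-hand side \<open>A\<^sup>TWb\<close> and one from the matrix
  \<open>A\<^sup>TWA\<close>, combine into the weighted residual \<open>W (b - A x)\<close>.
\<close>
lemma wls_map_has_derivative: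
  fixes A :: "real^'n^'m" and b :: "real^'m" and W :: "real^'m^'m" and L :: "real^'k^'n"
  assumes inv: "invertible (transpose A ** W ** A)"
  defines "N \<equiv> matrix_inv (transpose A ** W ** A)"
    and "x \<equiv> weighted_pinv W A *v b"
  shows "(wls_map W L has_derivative
   (\<lambda>(\<Delta>A, \<Delta>b). transpose L *v (N *v
       (transpose \<Delta>A *v (W *v (b - A *v x)) - transpose A *v (W *v (\<Delta>A *v x))
        + transpose A *v (W *v \<Delta>b))))) (at (A, b))"
proof -
  let ?M = "\<lambda>q::(real^'n^'m) \<times> (real^'m). transpose (fst q) ** (W ** fst q)"
  let ?c = "\<lambda>q::(real^'n^'m) \<times> (real^'m). transpose (fst q) *v (W *v snd q)"
  have t: "((\<lambda>q. transpose (fst q)) has_derivative (\<lambda>h. transpose (fst h))) (at (A, b))"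
    by (intro bounded_linear.has_derivative[OF bounded_linear_transpose] has_derivative_fst has_derivative_ident)
  have WA: "((\<lambda>q. W ** fst q) has_derivative (\<lambda>h. W ** fst h)) (at (A, b))"
    by (intro bounded_linear.has_derivative[OF bounded_bilinear.bounded_linear_right[OF bounded_bilinear_matrix_matrix_mult]]
       has_derivative_fst has_derivative_ident)
  have Wb: "((\<lambda>q. W *v snd q) has_derivative (\<lambda>h. W *v snd h)) (at (A, b))"
    by (intro bounded_linear.has_derivative[OF matrix_vector_mul_bounded_linear] has_derivative_snd has_derivative_ident)
  note M = bounded_bilinear.FDERIV[OF bounded_bilinear_matrix_matrix_mult t WA]
  note c = bounded_bilinear.FDERIV[OF bounded_bilinear_matrix_vector_mult t Wb]
  have x: "matrix_inv (?M (A, b)) *v ?c (A, b) = x" and N: "matrix_inv (?M (A, b)) = N"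
    by (simp_all only: x_def N_def weighted_pinv_def matrix_vector_mul_assoc matrix_mul_assoc fst_conv snd_conv)
  have g: "wls_map W L = (\<lambda>q. transpose L *v (matrix_inv (?M q) *v ?c q))"
    by (auto simp only: fun_eq_iff wls_map_def weighted_pinv_def matrix_vector_mul_assoc matrix_mul_assoc
       fst_conv snd_conv prod.case split: prod.split)
  have inv': "invertible (?M (A, b))"
    using inv by (simp add: matrix_mul_assoc)
  have eq: "transpose A *v (W *v e) + transpose D *v (W *v b)
        - (transpose A ** (W ** D) + transpose D ** (W ** A)) *v x
      = transpose D *v (W *v (b - A *v x)) - transpose A *v (W *v (D *v x))
        + transpose A *v (W *v e)" for D e
    by (simp only: matrix_vector_mult_add_rdistrib matrix_vector_mult_diff_distrib
        matrix_vector_mul_assoc[symmetric]) simp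
  note D = has_derivative_matrix_inv_solution[OF M c inv', unfolded x[unfolded N] N]
  show ?thesis
    unfolding g
    by (rule has_derivative_eq_rhs[OF bounded_linear.has_derivative[OF matrix_vector_mul_bounded_linear D]])
      (simp only: fun_eq_iff split_paired_All prod.case fst_conv snd_conv eq simp_thms)
qed

text \<open>
  The \<open>j\<close>th summand is \<open>e\<^sub>j\<close> times the inner product of \<open>d\<close> with the \<open>j\<close>th column, that is, the
  \<open>j\<close>th component of the right-hand side.
\<close>
lemma outer_product_axis_sum_columns:
  fixes D :: "real^'n^'m"
  shows "(\<Sum>j\<in>UNIV. outer_product (axis j 1) d *v column j D) = transpose D *v d"
proof -
  have "(outer_product (axis j 1) d *v column j D) $ i
      = (if j = i then (transpose D *v d) $ i else 0)" for i j
    by (simp add: matrix_vector_mult_def outer_product_def column_def axis_def transpose_def mult.commute)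
  then show ?thesis
    by (simp add: vec_eq_iff)
qed

text \<open>
  In the derivative \<open>D = \<Delta>A\<close> occurs once transposed and once not. Collecting terms by the columns
  of \<open>D\<close> makes each entry of \<open>D\<close> occur exactly once in each component, with an explicit
  coefficient; only in that form can moduli be taken termwise without losing sharpness.
\<close>
lemma wls_derivative_by_columns:
  fixes A :: "real^'n^'m" and L :: "real^'k^'n"
  shows "transpose L *v (N *v (transpose D *v d - transpose A *v (W *v (D *v x)) + transpose A *v (W *v e)))
   = (\<Sum>j\<in>UNIV. (transpose L ** N ** (outer_product (axis j 1) d - (x $ j) *\<^sub>R (transpose A ** W))) *v column j D)
     + (transpose L ** (N ** transpose A ** W)) *v e"
proof -
  have "D *v x = (\<Sum>j\<in>UNIV. (x $ j) *\<^sub>R column j D)"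
    by (simp add: matrix_mult_sum scalar_mult_eq_scaleR)
  then have "transpose A *v (W *v (D *v x)) = (\<Sum>j\<in>UNIV. ((x $ j) *\<^sub>R (transpose A ** W)) *v column j D)"
    by (simp only: linear_sum[OF matrix_vector_mul_linear] matrix_vector_mult_scaleR
       scaleR_matrix_vector_assoc[symmetric] matrix_vector_mul_assoc)
  then have "transpose D *v d - transpose A *v (W *v (D *v x))
     = (\<Sum>j\<in>UNIV. (outer_product (axis j 1) d - (x $ j) *\<^sub>R (transpose A ** W)) *v column j D)"
    by (simp only: outer_product_axis_sum_columns[symmetric] sum_subtractf matrix_vector_mult_diff_rdistrib)
  then show ?thesis
    by (simp only: matrix_vector_right_distrib linear_sum[OF matrix_vector_mul_linear]
      matrix_vector_mul_assoc matrix_mul_assoc)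
qed

section \<open>The componentwise norm and the condition number\<close>

lemma eventually_dominated_by_multiple:
  assumes "a = 0 \<longrightarrow> d = (0::real)" shows "\<forall>\<^sub>F w in at_top. \<bar>d\<bar> \<le> w * \<bar>a\<bar>"
proof (cases "a = 0")
  case False
  show ?thesis
    using eventually_ge_at_top[of "\<bar>d\<bar> / \<bar>a\<bar>"]
    by (rule eventually_mono) (use False in \<open>simp add: field_simps\<close>)
qed (use assms in simp)

text \<open>
  The set of admissible bounds \<open>\<omega>\<close> is closed, nonempty because the perturbation vanishes wherever
  the data do, and bounded below because a nonzero entry of \<open>A\<close> excludes negative \<open>\<omega>\<close>. Hence its
  infimum belongs to it and is the minimum meant by the definition.
\<close>
lemma componentwise_norm_attained:
  fixes A \<Delta>A :: "real^'n^'m" and b \<Delta>b :: "real^'m"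
  assumes "A \<noteq> 0" "admissible (A, b) (\<Delta>A, \<Delta>b)"
  defines "\<omega> \<equiv> componentwise_norm (A, b) (\<Delta>A, \<Delta>b)"
  shows "\<bar>\<Delta>A\<bar> \<le> \<omega> *\<^sub>R \<bar>A\<bar>" "\<bar>\<Delta>b\<bar> \<le> \<omega> *\<^sub>R \<bar>b\<bar>"
proof -
  define S where "S = {w. \<bar>\<Delta>A\<bar> \<le> w *\<^sub>R \<bar>A\<bar> \<and> \<bar>\<Delta>b\<bar> \<le> w *\<^sub>R \<bar>b\<bar>}"
  have "closed S"
    unfolding S_def less_eq_vec_def abs_vec_def
    by (intro closed_Collect_conj closed_Collect_all closed_Collect_le) (auto intro!: continuous_intros)
  have "\<forall>\<^sub>F w in at_top. w \<in> S"
    using assms(2)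
    by (simp add: S_def less_eq_vec_def abs_vec_def eventually_conj_iff admissible_def
        eventually_all_finite eventually_dominated_by_multiple)
  then have ne: "S \<noteq> {}"
    by (auto simp: eventually_at_top_linorder)
  obtain i j where ij: "A $ i $ j \<noteq> 0"
    using assms(1) by (auto simp: vec_eq_iff)
  have nonneg: "0 \<le> w" if "w \<in> S" for w
  proof -
    have "\<bar>\<Delta>A $ i $ j\<bar> \<le> w * \<bar>A $ i $ j\<bar>"
      using that by (simp add: S_def less_eq_vec_def abs_vec_def)
    then have "0 \<le> w * \<bar>A $ i $ j\<bar>"
      by linarith
    then show ?thesis
      using ij by (simp add: zero_le_mult_iff)
  qed
  have bdd: "bdd_below S"
    using nonneg by (rule bdd_belowI)
  have "Inf S \<in> S"
    by (rule closed_contains_Inf[OF ne bdd \<open>closed S\<close>])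
  moreover have "\<omega> = Inf S"
    unfolding \<omega>_def componentwise_norm_def prod.case
    by (rule Least_equality) (use \<open>Inf S \<in> S\<close> cInf_lower[OF _ bdd] in \<open>auto simp: S_def\<close>)
  ultimately show "\<bar>\<Delta>A\<bar> \<le> \<omega> *\<^sub>R \<bar>A\<bar>" "\<bar>\<Delta>b\<bar> \<le> \<omega> *\<^sub>R \<bar>b\<bar>"
    by (auto simp: S_def)
qed

lemma componentwise_norm_eq_1:
  fixes A \<Delta>A :: "real^'n^'m" and b \<Delta>b :: "real^'m"
  assumes "A \<noteq> 0" "\<bar>\<Delta>A\<bar> = \<bar>A\<bar>" "\<bar>\<Delta>b\<bar> = \<bar>b\<bar>"
  shows "componentwise_norm (A, b) (\<Delta>A, \<Delta>b) = 1"
proof -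
  obtain i j where ij: "A $ i $ j \<noteq> 0"
    using assms(1) by (auto simp: vec_eq_iff)
  have "1 \<le> w" if "\<bar>A\<bar> \<le> w *\<^sub>R \<bar>A\<bar>" for w
  proof -
    have "\<bar>A $ i $ j\<bar> \<le> w * \<bar>A $ i $ j\<bar>"
      using that by (simp add: less_eq_vec_def abs_vec_def)
    then show ?thesis
      using ij by simp
  qed
  then show ?thesis
    unfolding componentwise_norm_def prod.case assms(2,3)
    by (intro Least_equality) auto
qed

lemma infnorm_attained:
  fixes v :: "real^'n"
  shows "\<exists>i. infnorm v = \<bar>v $ i\<bar>"
proof -
  have "{\<bar>v $ i\<bar> | i. i \<in> UNIV} = range (\<lambda>i. \<bar>v $ i\<bar>)"
    by auto
  then have "infnorm v = Max (range (\<lambda>i. \<bar>v $ i\<bar>))"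
    by (simp add: infnorm_cart cSup_eq_Max)
  moreover have "\<dots> \<in> range (\<lambda>i. \<bar>v $ i\<bar>)"
    by (rule Max_in) auto
  ultimately show ?thesis
    by (metis imageE)
qed

text \<open>
  In each component the derivative is a linear form in the entries of the perturbation, each
  entry occurring once. The triangle inequality is therefore sharp on the box of perturbations
  bounded by the data, with equality when the signs match those of the coefficients.
\<close>
lemma cond_inf_of_linear_derivative:
  fixes A :: "real^'n^'m" and b :: "real^'m" and C :: "'n \<Rightarrow> real^'m^'k" and B :: "real^'m^'k"
  assumes "A \<noteq> 0"
    and der: "(g has_derivative (\<lambda>(\<Delta>A, \<Delta>b). (\<Sum>j\<in>UNIV. C j *v column j \<Delta>A) + B *v \<Delta>b)) (at (A, b))"
  shows "cond_inf g (A, b) = infnorm ((\<Sum>j\<in>UNIV. \<bar>C j\<bar> *v \<bar>column j A\<bar>) + \<bar>B\<bar> *v \<bar>b\<bar>)"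
    (is "_ = infnorm ?F")
proof -
  define T where "T = (\<lambda>(\<Delta>A, \<Delta>b). (\<Sum>j\<in>UNIV. C j *v column j \<Delta>A) + B *v \<Delta>b)"
  have fd: "frechet_derivative g (at (A, b)) = T"
    using frechet_derivative_at[OF der] by (simp add: T_def)
  have T_nth: "T (\<Delta>A, \<Delta>b) $ i =
      (\<Sum>j\<in>UNIV. \<Sum>l\<in>UNIV. C j $ i $ l * \<Delta>A $ l $ j) + (\<Sum>l\<in>UNIV. B $ i $ l * \<Delta>b $ l)" for \<Delta>A \<Delta>b i
    by (simp add: T_def matrix_vector_mult_def column_def)
  have F_nth: "?F $ i = (\<Sum>j\<in>UNIV. \<Sum>l\<in>UNIV. \<bar>C j $ i $ l\<bar> * \<bar>A $ l $ j\<bar>)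
      + (\<Sum>l\<in>UNIV. \<bar>B $ i $ l\<bar> * \<bar>b $ l\<bar>)" for i
    by (simp add: matrix_vector_mult_def column_def abs_vec_def)
  have F_nonneg: "0 \<le> ?F $ i" for i
    unfolding F_nth by (intro add_nonneg_nonneg sum_nonneg) auto
  have upper: "infnorm (T (\<Delta>A, \<Delta>b)) \<le> infnorm ?F"
    if "\<bar>\<Delta>A\<bar> \<le> \<bar>A\<bar>" "\<bar>\<Delta>b\<bar> \<le> \<bar>b\<bar>" for \<Delta>A \<Delta>b
  proof -
    have "\<bar>\<Delta>A $ l $ j\<bar> \<le> \<bar>A $ l $ j\<bar>" "\<bar>\<Delta>b $ l\<bar> \<le> \<bar>b $ l\<bar>" for l j
      using that by (simp_all add: less_eq_vec_def abs_vec_def)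
    then have "\<bar>T (\<Delta>A, \<Delta>b) $ i\<bar> \<le> ?F $ i" for i
      unfolding T_nth F_nth
      by (intro order_trans[OF abs_triangle_ineq] add_mono order_trans[OF sum_abs] sum_mono)
         (auto simp: abs_mult intro!: mult_left_mono)
    then have "\<bar>T (\<Delta>A, \<Delta>b) $ i\<bar> \<le> infnorm ?F" for i
      using component_le_infnorm_cart[of ?F i] by (meson abs_ge_self order_trans)
    then show ?thesis
      unfolding infnorm_cart[of "T _"] by (intro cSup_least) auto
  qed
  obtain i where i: "infnorm ?F = ?F $ i"
    using infnorm_attained[of ?F] by (auto simp only: abs_of_nonneg[OF F_nonneg])
  \<comment> \<open>The sign of \<open>0\<close> is taken to be \<open>1\<close>: with \<open>sgn\<close>, entries with coefficient \<open>0\<close> would vanish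
     and the perturbation could have norm less than \<open>1\<close>.\<close>
  define \<sigma> :: "real \<Rightarrow> real" where "\<sigma> t = (if 0 \<le> t then 1 else - 1)" for t
  have \<sigma>: "\<bar>\<sigma> t\<bar> = 1" "t * \<sigma> t = \<bar>t\<bar>" for t
    by (auto simp: \<sigma>_def)
  define \<Delta>A :: "real^'n^'m" where "\<Delta>A = (\<chi> l j. \<sigma> (C j $ i $ l) * \<bar>A $ l $ j\<bar>)"
  define \<Delta>b :: "real^'m" where "\<Delta>b = (\<chi> l. \<sigma> (B $ i $ l) * \<bar>b $ l\<bar>)"
  have abs\<Delta>: "\<bar>\<Delta>A\<bar> = \<bar>A\<bar>" "\<bar>\<Delta>b\<bar> = \<bar>b\<bar>"
    by (simp_all add: \<Delta>A_def \<Delta>b_def vec_eq_iff abs_vec_def abs_mult \<sigma>)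
  have adm: "admissible (A, b) (\<Delta>A, \<Delta>b)"
    by (simp add: admissible_def \<Delta>A_def \<Delta>b_def)
  have "T (\<Delta>A, \<Delta>b) $ i = ?F $ i"
    unfolding T_nth F_nth by (simp add: \<Delta>A_def \<Delta>b_def \<sigma> mult.assoc[symmetric])
  then have "infnorm ?F \<le> infnorm (T (\<Delta>A, \<Delta>b))"
    using component_le_infnorm_cart[of "T (\<Delta>A, \<Delta>b)" i] i by linarith
  then have attained: "infnorm (T (\<Delta>A, \<Delta>b)) = infnorm ?F"
    using upper[of \<Delta>A \<Delta>b] abs\<Delta> by simp
  show ?thesis
    unfolding cond_inf_def fd
  proof (rule Greatest_equality)
    show "\<exists>\<Delta>. admissible (A, b) \<Delta> \<and> componentwise_norm (A, b) \<Delta> = 1 \<and> infnorm ?F = infnorm (T \<Delta>)"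
      using adm attained componentwise_norm_eq_1[OF assms(1) abs\<Delta>] by metis
  next
    fix r
    assume "\<exists>\<Delta>. admissible (A, b) \<Delta> \<and> componentwise_norm (A, b) \<Delta> = 1 \<and> r = infnorm (T \<Delta>)"
    then obtain D d where D: "admissible (A, b) (D, d)" "componentwise_norm (A, b) (D, d) = 1"
      "r = infnorm (T (D, d))" by auto
    then show "r \<le> infnorm ?F"
      using upper[of D d] componentwise_norm_attained[OF assms(1) D(1)] by simp
  qed
qed

theorem corollary7:
  fixes A :: "real^'n^'m" and b :: "real^'m" and W :: "real^'m^'m" and L :: "real^'k^'n"
  assumes "CARD('n) \<le> CARD('m)"
    and "CARD('k) \<le> CARD('n)"
    and "rank A = CARD('n)"
    and "symmetric_positive_definite W"
  shows "let x = weighted_pinv W A *v b;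
             d = W *v (b - A *v x)
         in cond_inf (wls_map W L) (A, b) =
              infnorm ((\<Sum>j\<in>UNIV.
                  \<bar>transpose L ** matrix_inv (transpose A ** W ** A) **
                    (outer_product (axis j 1) d - (x $ j) *\<^sub>R (transpose A ** W))\<bar> *v \<bar>column j A\<bar>)
                + \<bar>transpose L ** weighted_pinv W A\<bar> *v \<bar>b\<bar>)"
proof -
  have gram: "invertible (transpose A ** W ** A)"
    using assms(3,4) by (intro invertible_gram) (auto simp: symmetric_positive_definite_def)
  have "A \<noteq> 0"
  proof
    assume "A = 0"
    then have "transpose A ** W ** A = mat 0"
      by (simp add: matrix_matrix_mult_def mat_def vec_eq_iff)
    with gram show False
      by (simp only: invertible_det_nz det_0 simp_thms)
  qed
  show ?thesis
    unfolding Let_def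
    by (rule cond_inf_of_linear_derivative[OF \<open>A \<noteq> 0\<close> wls_map_has_derivative[OF gram,
          unfolded wls_derivative_by_columns, folded weighted_pinv_def]])
qed

end
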